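(* For all $k\in\mathbb N$ and $\kappa>0$, the zeros in $(0,\infty)$ of the function $F_k$ (defined in the context) can be ordered as an increasing sequence $\alpha_{k,\ell}=\alpha_{k,\ell}(\kappa)>0$, $\ell\in\mathbb Z$, such that: $\alpha_{k,-\ell}=\kappa/\alpha_{k,\ell}$ for all $\ell\ge0$; $\alpha_{k,0}=\sqrt\kappa$; $\alpha_{k,\ell}>\sqrt\kappa>\alpha_{k,-\ell}$ for all $\ell>0$; $\alpha_{k,\ell}\to+\infty$ as $\ell\to+\infty$; $\alpha_{k,\ell}\to0$ as $\ell\to-\infty$. Each $\ell\ne0$ gives rise to the eigenvalue $$\lambda_{k,\ell}=\alpha_{k,\ell}^2+\frac{\kappa^2}{\alpha_{k,\ell}^2}=\alpha_{k,\ell}^2+\alpha_{k,-\ell}^2$$ of the problem $\Delta^2u+\kappa^2u=-\lambda\Delta u$ in $D_1$, $u=\partial_ru=0$ on $\partial D_1$, and to a corresponding eigenfunction of the form $R_{k,\ell}(r)e^{\mathbf i k\theta}$ with $R_{k,\ell}(r)=cJ_k(\alpha_{k,\ell}r)+dJ_k(\alpha_{k,-\ell}r)$, where $(c,d)\neq(0,0)$ is a solution, with $\alpha=\alpha_{k,\ell}$, of the system $$cJ_k(\alpha)+dJ_k\left(\tfrac{\kappa}{\alpha}\right)=0,\qquad c\,\alpha J_k'(\alpha)+d\,\tfrac{\kappa}{\alpha}J_k'\left(\tfrac{\kappa}{\alpha}\right)=0.$$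
   Context: $\mathbb N=\{0,1,2,\dots\}$; $D_1=\{x\in\mathbb R^2:|x|<1\}$; $(r,\theta)$ are polar coordinates; $J_k$ is the Bessel function of the first kind of order $k$. For $\kappa>0$ and $k\in\mathbb N$, $F_k:(0,\infty)\to\mathbb R$ is $F_k(\alpha)=\frac{\kappa}{\alpha}J_k(\alpha)J_k'\left(\frac{\kappa}{\alpha}\right)-\alpha J_k\left(\frac{\kappa}{\alpha}\right)J_k'(\alpha)$. An eigenvalue is a number $\lambda$ for which the problem has a nonzero solution $u$ (an eigenfunction). *)

theory Defs
  imports "HOL-Analysis.Analysis"
begin

definition bessel_J :: "nat \<Rightarrow> real \<Rightarrow> real" where
  "bessel_J k x = (\<Sum>m. (-1) ^ m / (fact m * fact (m + k)) * (x / 2) ^ (2 * m + k))"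

definition bessel_F :: "real \<Rightarrow> nat \<Rightarrow> real \<Rightarrow> real" where
  "bessel_F \<kappa> k \<alpha> =
     \<kappa> / \<alpha> * bessel_J k \<alpha> * deriv (bessel_J k) (\<kappa> / \<alpha>)
     - \<alpha> * bessel_J k (\<kappa> / \<alpha>) * deriv (bessel_J k) \<alpha>"

definition partial_deriv ::
  "'a::euclidean_space \<Rightarrow> ('a \<Rightarrow> 'b::real_normed_vector) \<Rightarrow> 'a \<Rightarrow> 'b" where
  "partial_deriv b u x = frechet_derivative u (at x) b"

definition laplacian ::
  "('a::euclidean_space \<Rightarrow> 'b::real_normed_vector) \<Rightarrow> 'a \<Rightarrow> 'b" where
  "laplacian u x = (\<Sum>b\<in>Basis. partial_deriv b (partial_deriv b u) x)"

primrec iterated_partial ::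
  "'a::euclidean_space list \<Rightarrow> ('a \<Rightarrow> 'b::real_normed_vector) \<Rightarrow> 'a \<Rightarrow> 'b" where
  "iterated_partial [] u = u"
| "iterated_partial (b # bs) u = partial_deriv b (iterated_partial bs u)"

text \<open>The space of functions of class \<open>C\<^sup>n\<close> on the closure of the open set \<open>S\<close>: \<open>u\<close> is
  continuous on the closure, and all partial derivatives of order at most \<open>n\<close> exist in \<open>S\<close> and
  extend continuously to the closure. Differentiability is demanded of the partial derivatives
  of order less than \<open>n\<close>, since \<open>frechet_derivative\<close> is unspecified otherwise.\<close>

definition C_closure ::
  "nat \<Rightarrow> 'a::euclidean_space set \<Rightarrow> ('a \<Rightarrow> 'b::real_normed_vector) \<Rightarrow> bool" where
  "C_closure n S u \<longleftrightarrow>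
     continuous_on (closure S) u \<and>
     (\<forall>bs. set bs \<subseteq> Basis \<and> length bs < n \<longrightarrow>
        (\<forall>x\<in>S. iterated_partial bs u differentiable (at x))) \<and>
     (\<forall>bs. set bs \<subseteq> Basis \<and> length bs \<le> n \<longrightarrow>
        (\<exists>g. continuous_on (closure S) g \<and> (\<forall>x\<in>S. g x = iterated_partial bs u x)))"

abbreviation D1 :: "(real ^ 2) set" where
  "D1 \<equiv> ball 0 1"

text \<open>Classical solutions up to the boundary. The radial derivative at a boundary point is taken
  from inside the disc, so that only the values of \<open>u\<close> on the closed disc matter.\<close>

definition clamped_solution :: "real \<Rightarrow> real \<Rightarrow> (real ^ 2 \<Rightarrow> complex) \<Rightarrow> bool" where
  "clamped_solution \<kappa> \<mu> u \<longleftrightarrow>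
     C_closure 4 D1 u \<and>
     (\<forall>x\<in>D1. laplacian (laplacian u) x + of_real (\<kappa>\<^sup>2) * u x = - of_real \<mu> * laplacian u x) \<and>
     (\<forall>x\<in>frontier D1. u x = 0 \<and>
        ((\<lambda>r. u (r *\<^sub>R x)) has_vector_derivative 0) (at 1 within {0..1}))"

definition clamped_eigenfunction :: "real \<Rightarrow> real \<Rightarrow> (real ^ 2 \<Rightarrow> complex) \<Rightarrow> bool" where
  "clamped_eigenfunction \<kappa> \<mu> u \<longleftrightarrow> clamped_solution \<kappa> \<mu> u \<and> (\<exists>x\<in>D1. u x \<noteq> 0)"

definition clamped_eigenvalue :: "real \<Rightarrow> real \<Rightarrow> bool" where
  "clamped_eigenvalue \<kappa> \<mu> \<longleftrightarrow> (\<exists>u. clamped_eigenfunction \<kappa> \<mu> u)"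

definition bessel_system :: "real \<Rightarrow> nat \<Rightarrow> real \<Rightarrow> complex \<Rightarrow> complex \<Rightarrow> bool" where
  "bessel_system \<kappa> k \<alpha> c d \<longleftrightarrow>
     c * of_real (bessel_J k \<alpha>) + d * of_real (bessel_J k (\<kappa> / \<alpha>)) = 0 \<and>
     c * of_real (\<alpha> * deriv (bessel_J k) \<alpha>)
       + d * of_real (\<kappa> / \<alpha> * deriv (bessel_J k) (\<kappa> / \<alpha>)) = 0"

text \<open>The function \<open>R(r) e\<^sup>i\<^sup>k\<^sup>\<theta>\<close> in polar coordinates. At the origin \<open>Arg 0 = 0\<close>; this choice is
  immaterial for the radial profiles used here, as \<open>R(0) = 0\<close> when \<open>k > 0\<close>.\<close>

definition polar_mode :: "nat \<Rightarrow> (real \<Rightarrow> complex) \<Rightarrow> real ^ 2 \<Rightarrow> complex" where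
  "polar_mode k R x = R (norm x) * exp (\<i> * of_nat k * of_real (Arg (Complex (x $ 1) (x $ 2))))"

end

theory Submission
  imports Defs "HOL-Complex_Analysis.Complex_Analysis"
begin

text \<open>
  The function \<open>F\<^sub>k(\<alpha>)\<close> is \<open>-\<alpha>\<close> times the derivative of \<open>\<phi>(\<alpha>) = J\<^sub>k(\<alpha>) J\<^sub>k(\<kappa>/\<alpha>)\<close>. Hence it is
  anti-invariant under \<open>\<alpha> \<mapsto> \<kappa>/\<alpha>\<close>, it has a zero between any two zeros of \<open>J\<^sub>k\<close>, and, being
  analytic and not identically zero, it has only finitely many zeros in a compact subinterval of
  \<open>(0,\<infinity>)\<close>. So the zeros above \<open>\<surd>\<kappa>\<close> form a sequence tending to infinity, and the others are their
  reflections.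

  Everything is reduced to the Bessel-Clifford functions \<open>C\<^sub>k(z) = \<Sum>\<^sub>m z\<^sup>m / (m! (m + k)!)\<close>, which
  satisfy \<open>C\<^sub>k' = C\<^bsub>k+1\<^esub>\<close> and \<open>J\<^sub>k(x) = (x/2)\<^sup>k C\<^sub>k(-x\<^sup>2/4)\<close>. In particular \<open>J\<^sub>k(\<alpha>r) e\<^sup>i\<^sup>k\<^sup>\<theta>\<close> is
  \<open>(\<alpha>z/2)\<^sup>k C\<^sub>k(-\<alpha>\<^sup>2|z|\<^sup>2/4)\<close>, smooth on the whole plane, and an eigenfunction of the Laplacian for
  \<open>-\<alpha>\<^sup>2\<close>; the fourth order equation factors as \<open>(\<Delta> + \<alpha>\<^sup>2)(\<Delta> + \<kappa>\<^sup>2/\<alpha>\<^sup>2) u = 0\<close>.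
\<close>

section \<open>Bessel-Clifford functions\<close>

text \<open>Equal to \<open>z^(-k/2) I_k(2 sqrt z)\<close> with the modified Bessel function
  \<open>I_k\<close>, hence entire, with no branch to choose. It is generic in the field: Rolle and
  sign arguments use the real instance, the identity theorem and the waves the complex one.\<close>

definition bessel_clifford :: "nat \<Rightarrow> 'a::{real_normed_field,banach} \<Rightarrow> 'a" where
  "bessel_clifford k z = (\<Sum>m. inverse (fact m * fact (m + k)) * z ^ m)"

lemma bessel_clifford_summable:
  fixes z :: "'a::{real_normed_field,banach}"
  shows "summable (\<lambda>m. inverse (fact m * fact (m + k)) * z ^ m)"
proof (rule summable_comparison_test)
  show "summable (\<lambda>m. norm (z ^ m /\<^sub>R fact m))"
    by (rule summable_norm_exp)
  have "norm (inverse (fact m * fact (m + k)) * z ^ m) \<le> norm (z ^ m /\<^sub>R fact m)" for m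
  proof -
    have "1 \<le> (fact (m + k) :: real)" by simp
    then have "inverse (fact m * fact (m + k) :: real) \<le> inverse (fact m)"
      by (intro le_imp_inverse_le) auto
    then have "inverse (fact m * fact (m + k)) * norm (z ^ m) \<le> inverse (fact m) * norm (z ^ m)"
      by (rule mult_right_mono) simp
    then show ?thesis
      by (simp only: norm_mult norm_inverse norm_scaleR norm_fact flip: real_norm_def)
  qed
  then show "\<exists>N. \<forall>m\<ge>N. norm (inverse (fact m * fact (m + k)) * z ^ m) \<le> norm (z ^ m /\<^sub>R fact m)"
    by blast
qed

text \<open>Termwise differentiation cancels a factor \<open>m + 1\<close> against
  \<open>(m + 1)!\<close>, while the other factorial stays at \<open>(m + 1 + k)!\<close> and so
  carries the index \<open>k + 1\<close>.\<close>

lemma has_field_derivative_bessel_clifford: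
  "(bessel_clifford k has_field_derivative bessel_clifford (Suc k) z) (at z)"
proof -
  define c :: "nat \<Rightarrow> 'a" where "c m = inverse (fact m * fact (m + k))" for m
  have "diffs c m = inverse (fact m * fact (m + Suc k))" for m
    by (simp add: diffs_def c_def del: of_nat_Suc)
  moreover have "((\<lambda>z. \<Sum>m. c m * z ^ m) has_field_derivative (\<Sum>m. diffs c m * z ^ m)) (at z)"
    by (rule termdiffs_strong_converges_everywhere)
      (use bessel_clifford_summable[of k] in \<open>simp add: c_def\<close>)
  ultimately show ?thesis
    unfolding bessel_clifford_def[abs_def] by (simp add: c_def)
qed

lemmas has_field_derivative_bessel_clifford' [derivative_intros] =
  DERIV_chain2[OF has_field_derivative_bessel_clifford]

lemma continuous_on_bessel_clifford [continuous_intros]: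
  "continuous_on A f \<Longrightarrow> continuous_on A (\<lambda>x. bessel_clifford k (f x))"
  using continuous_on_compose2[of UNIV "bessel_clifford k" A f]
    DERIV_isCont[OF has_field_derivative_bessel_clifford]
  by (auto simp: continuous_on_eq_continuous_at)

lemma holomorphic_on_bessel_clifford [holomorphic_intros]:
  assumes "f holomorphic_on A"
  shows "(\<lambda>z. bessel_clifford k (f z)) holomorphic_on A"
proof -
  have "bessel_clifford k holomorphic_on UNIV"
    using has_field_derivative_bessel_clifford by (auto simp: holomorphic_on_open)
  from holomorphic_on_compose_gen[OF assms this] show ?thesis
    by (simp add: o_def)
qed

text \<open>As \<open>C_k' = C_(k+1)\<close>, this is the differential equation
  \<open>z C_k'' + (k + 1) C_k' = C_k\<close>, Bessel's equation in these variables. It holds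
  coefficient by coefficient.\<close>

lemma bessel_clifford_recurrence:
  fixes z :: "'a::{real_normed_field,banach}"
  shows "z * bessel_clifford (Suc (Suc k)) z + of_nat (Suc k) * bessel_clifford (Suc k) z
    = bessel_clifford k z"
proof -
  define b :: "nat \<Rightarrow> nat \<Rightarrow> 'a" where "b k m = inverse (fact m * fact (m + k)) * z ^ m" for k m
  \<comment> \<open>The series of \<open>z * C_(k+2)\<close>, shifted by one index so that equal
    powers of \<open>z\<close> line up.\<close>
  define s where "s m = (case m of 0 \<Rightarrow> 0 | Suc n \<Rightarrow> z * b (Suc (Suc k)) n)" for m
  have sum_b: "b k sums bessel_clifford k z" for k
    unfolding b_def bessel_clifford_def by (rule summable_sums[OF bessel_clifford_summable])
  have "s sums (z * bessel_clifford (Suc (Suc k)) z)"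
  proof (rule sums_Suc_imp)
    show "s 0 = 0"
      by (simp add: s_def)
    show "(\<lambda>m. s (Suc m)) sums (z * bessel_clifford (Suc (Suc k)) z)"
      using sums_mult[OF sum_b, of z "Suc (Suc k)"] by (simp add: s_def)
  qed
  then have "(\<lambda>m. s m + of_nat (Suc k) * b (Suc k) m) sums
      (z * bessel_clifford (Suc (Suc k)) z + of_nat (Suc k) * bessel_clifford (Suc k) z)"
    by (intro sums_add sums_mult sum_b)
  moreover have "s m + of_nat (Suc k) * b (Suc k) m = b k m" for m
  proof (cases m)
    case 0
    then show ?thesis
      by (simp add: s_def b_def del: of_nat_Suc)
  next
    case (Suc n)
    have step: "inverse (fact j) = (of_nat (Suc j) * inverse (fact (Suc j)) :: 'a)" for j
      by (simp del: of_nat_Suc)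
    \<comment> \<open>All three terms at \<open>z ^ Suc n\<close> are multiples of \<open>E\<close>,
      and the identity becomes \<open>(n + 1) + (k + 1) = n + k + 2\<close>.\<close>
    define E where "E = inverse (fact (Suc n) * fact (Suc (Suc (n + k)))) * z ^ Suc n"
    have "z * b (Suc (Suc k)) n = of_nat (Suc n) * E"
      unfolding b_def E_def by (simp add: step[of n] del: of_nat_Suc fact_Suc)
    moreover have "b (Suc k) (Suc n) = E"
      unfolding b_def E_def by (simp del: of_nat_Suc fact_Suc)
    moreover have "b k (Suc n) = of_nat (Suc (Suc (n + k))) * E"
      unfolding b_def E_def by (simp add: step[of "Suc (n + k)"] del: of_nat_Suc fact_Suc)
    ultimately show ?thesis
      by (simp add: Suc s_def distrib_right[symmetric])
  qed
  ultimately show ?thesis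
    using sum_b[of k] sums_unique2 by auto
qed

lemma of_real_bessel_clifford:
  "of_real (bessel_clifford k x) = (bessel_clifford k (of_real x) :: 'a::{real_normed_field,banach})"
  unfolding bessel_clifford_def
  by (subst suminf_of_real[OF bessel_clifford_summable]) simp

lemma bessel_clifford_0: "bessel_clifford k 0 = inverse (fact k)"
  unfolding bessel_clifford_def by (subst powser_zero) simp

section \<open>The function \<open>F\<^sub>k\<close> and its zeros\<close>

lemma bessel_J_eq_bessel_clifford:
  "bessel_J k x = (x / 2) ^ k * bessel_clifford k (- (x\<^sup>2 / 4))"
proof -
  have "(-1) ^ m / (fact m * fact (m + k)) * (x / 2) ^ (2 * m + k)
      = (x / 2) ^ k * (inverse (fact m * fact (m + k)) * (- (x\<^sup>2 / 4)) ^ m)" for m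
  proof -
    have "(- (x\<^sup>2 / 4)) ^ m = (-1) ^ m * (x / 2) ^ (2 * m)"
      by (subst power_minus) (simp add: power_mult power_divide)
    then show ?thesis by (simp add: power_add field_simps)
  qed
  then show ?thesis
    unfolding bessel_J_def bessel_clifford_def
    by (simp only: suminf_mult bessel_clifford_summable)
qed

text \<open>The derivative is left as \<open>deriv\<close> because \<open>bessel_F\<close> is
  written with it.\<close>

lemma DERIV_bessel_J:
  "(bessel_J k has_real_derivative deriv (bessel_J k) x) (at x)"
proof -
  have "\<exists>D. ((\<lambda>x. (x / 2) ^ k * bessel_clifford k (- (x\<^sup>2 / 4))) has_real_derivative D) (at x)"
    by (rule exI, (rule derivative_eq_intros refl | simp)+)
  then have "\<exists>D. (bessel_J k has_real_derivative D) (at x)"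
    using bessel_J_eq_bessel_clifford[of k] by (metis (no_types, lifting) DERIV_cong_ev ext)
  then show ?thesis
    by (metis DERIV_imp_deriv)
qed

text \<open>The powers of \<open>\<alpha>\<close> in front of the two series cancel. What remains
  depends on \<open>\<alpha>\<^sup>2\<close> only and extends to the punctured complex
  plane.\<close>

lemma bessel_J_mult_inversion:
  assumes "\<alpha> \<noteq> 0"
  shows "bessel_J k \<alpha> * bessel_J k (\<kappa> / \<alpha>)
    = (\<kappa> / 4) ^ k * bessel_clifford k (- (\<alpha>\<^sup>2 / 4)) * bessel_clifford k (- (\<kappa>\<^sup>2 / (4 * \<alpha>\<^sup>2)))"
proof -
  have "(\<alpha> / 2) ^ k * (\<kappa> / \<alpha> / 2) ^ k = (\<kappa> / 4) ^ k"
    using assms by (simp flip: power_mult_distrib)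
  moreover have "(\<kappa> / \<alpha>)\<^sup>2 / 4 = \<kappa>\<^sup>2 / (4 * \<alpha>\<^sup>2)"
    by (simp add: power_divide)
  ultimately show ?thesis
    unfolding bessel_J_eq_bessel_clifford by (simp only: mult.assoc mult.left_commute) (simp add: mult.assoc[symmetric])
qed

lemma DERIV_bessel_J_mult_inversion:
  assumes "\<alpha> \<noteq> 0"
  shows "((\<lambda>\<alpha>. bessel_J k \<alpha> * bessel_J k (\<kappa> / \<alpha>)) has_real_derivative - bessel_F \<kappa> k \<alpha> / \<alpha>) (at \<alpha>)"
  unfolding bessel_F_def
  by (rule derivative_eq_intros DERIV_chain2[OF DERIV_bessel_J] refl assms | simp)+
    (use assms in \<open>simp add: field_simps power2_eq_square\<close>)

lemma bessel_F_inversion: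
  assumes "\<kappa> \<noteq> 0"
  shows "bessel_F \<kappa> k (\<kappa> / \<alpha>) = - bessel_F \<kappa> k \<alpha>"
  using assms by (simp add: bessel_F_def)

text \<open>The holomorphic extension of \<open>bessel_F\<close>: \<open>-z\<close> times the
  derivative of the right-hand side of \<open>bessel_J_mult_inversion\<close>, with
  \<open>C_k'\<close> written as \<open>C_(k+1)\<close>.\<close>

definition bessel_F_complex :: "real \<Rightarrow> nat \<Rightarrow> complex \<Rightarrow> complex" where
  "bessel_F_complex \<kappa> k z = (of_real \<kappa> / 4) ^ k *
    (z\<^sup>2 / 2 * bessel_clifford (Suc k) (- (z\<^sup>2 / 4)) * bessel_clifford k (- (of_real (\<kappa>\<^sup>2) / (4 * z\<^sup>2)))
     - of_real (\<kappa>\<^sup>2) / (2 * z\<^sup>2) * bessel_clifford k (- (z\<^sup>2 / 4)) * bessel_clifford (Suc k) (- (of_real (\<kappa>\<^sup>2) / (4 * z\<^sup>2))))"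

lemma holomorphic_bessel_F_complex: "bessel_F_complex \<kappa> k holomorphic_on - {0}"
  unfolding bessel_F_complex_def by (intro holomorphic_intros) auto

text \<open>The derivative of the product is computed twice, from its Bessel-Clifford form and from
  \<open>DERIV_bessel_J_mult_inversion\<close>; uniqueness of derivatives identifies the
  results.\<close>

lemma bessel_F_complex_of_real:
  assumes "\<alpha> \<noteq> 0"
  shows "bessel_F_complex \<kappa> k (of_real \<alpha>) = of_real (bessel_F \<kappa> k \<alpha>)"
proof -
  let ?\<phi> = "\<lambda>\<alpha>. (\<kappa> / 4) ^ k * bessel_clifford k (- (\<alpha>\<^sup>2 / 4)) * bessel_clifford k (- (\<kappa>\<^sup>2 / (4 * \<alpha>\<^sup>2)))"
  let ?D = "(\<kappa> / 4) ^ k *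
    (- (\<alpha> / 2) * bessel_clifford (Suc k) (- (\<alpha>\<^sup>2 / 4)) * bessel_clifford k (- (\<kappa>\<^sup>2 / (4 * \<alpha>\<^sup>2)))
     + \<kappa>\<^sup>2 / (2 * \<alpha> ^ 3) * bessel_clifford k (- (\<alpha>\<^sup>2 / 4)) * bessel_clifford (Suc k) (- (\<kappa>\<^sup>2 / (4 * \<alpha>\<^sup>2))))"
  have "(?\<phi> has_real_derivative ?D) (at \<alpha>)"
    by (rule derivative_eq_intros refl | simp add: assms)+
      (use assms in \<open>simp add: right_diff_distrib distrib_left eval_nat_numeral mult_ac\<close>)
  moreover have "(?\<phi> has_real_derivative - bessel_F \<kappa> k \<alpha> / \<alpha>) (at \<alpha>)"
  proof (rule has_field_derivative_transform_within_open[OF DERIV_bessel_J_mult_inversion[OF assms]])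
    show "open (- {0 :: real})" "\<alpha> \<in> - {0}" using assms by auto
  qed (simp add: bessel_J_mult_inversion)
  ultimately have "?D = - bessel_F \<kappa> k \<alpha> / \<alpha>"
    by (rule DERIV_unique)
  then have "bessel_F \<kappa> k \<alpha> = - \<alpha> * ?D"
    using assms by simp
  also have "\<dots> = (\<kappa> / 4) ^ k *
    (\<alpha>\<^sup>2 / 2 * bessel_clifford (Suc k) (- (\<alpha>\<^sup>2 / 4)) * bessel_clifford k (- (\<kappa>\<^sup>2 / (4 * \<alpha>\<^sup>2)))
     - \<kappa>\<^sup>2 / (2 * \<alpha>\<^sup>2) * bessel_clifford k (- (\<alpha>\<^sup>2 / 4)) * bessel_clifford (Suc k) (- (\<kappa>\<^sup>2 / (4 * \<alpha>\<^sup>2))))"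
    using assms by (simp add: right_diff_distrib distrib_left eval_nat_numeral mult_ac)
  finally have "bessel_F \<kappa> k \<alpha> = \<dots>" .
  then show ?thesis
    by (simp add: bessel_F_complex_def of_real_bessel_clifford)
qed

section \<open>Arbitrarily large zeros\<close>

lemma Rolle_DERIV:
  fixes f f' :: "real \<Rightarrow> real"
  assumes "a < b" "f a = f b" and f': "\<And>x. a \<le> x \<Longrightarrow> x \<le> b \<Longrightarrow> (f has_real_derivative f' x) (at x)"
  shows "\<exists>z. a < z \<and> z < b \<and> f' z = 0"
proof -
  have "continuous_on {a..b} f"
    using f' by (meson DERIV_isCont atLeastAtMost_iff continuous_at_imp_continuous_on)
  moreover have "f differentiable (at x)" if "a < x" "x < b" for x
    using f'[of x] that real_differentiable_def by auto
  ultimately obtain z where "a < z" "z < b" "(f has_real_derivative 0) (at z)"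
    using Rolle[OF assms(1,2)] by blast
  with f'[of z] show ?thesis
    by (metis DERIV_unique less_imp_le)
qed

text \<open>The system says \<open>(t G')' = -G\<close> with \<open>P = t G'\<close>, so \<open>P\<close> decreases. Once \<open>P\<close> is negative, \<open>G\<close>
  lies below a negative multiple of \<open>ln t\<close>; if it never is, \<open>G\<close> increases and \<open>P\<close> falls linearly.\<close>

lemma Bessel_0_no_positive_solution:
  fixes G P :: "real \<Rightarrow> real"
  assumes "A > 0"
    and G: "\<And>t. t \<ge> A \<Longrightarrow> (G has_real_derivative P t / t) (at t)"
    and P: "\<And>t. t \<ge> A \<Longrightarrow> (P has_real_derivative - G t) (at t)"
    and pos: "\<And>t. t \<ge> A \<Longrightarrow> G t > 0"
  shows False
proof (cases "\<exists>t\<ge>A. P t < 0")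
  case True
  then obtain t1 where t1: "t1 \<ge> A" "P t1 < 0" by blast
  have P_le: "P t \<le> P t1" if "t \<ge> t1" for t
    using t1 that P pos
    by (intro DERIV_nonpos_imp_nonincreasing[OF that]) (metis less_imp_le neg_le_0_iff_le order_trans)
  \<comment> \<open>Here \<open>ln (t / t1)\<close> makes the logarithmic bound
    \<open>G t1 + P t1 * ln (t / t1)\<close> vanish.\<close>
  define t where "t = t1 * exp (G t1 / - P t1)"
  have "G t1 / - P t1 > 0"
    using t1 pos by (intro divide_pos_pos) auto
  then have "t1 \<le> t"
    using t1 assms(1) by (simp add: t_def)
  have "G t - P t1 * ln t \<le> G t1 - P t1 * ln t1"
  proof (rule DERIV_nonpos_imp_nonincreasing[OF \<open>t1 \<le> t\<close>])
    fix s assume s: "t1 \<le> s"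
    have "((\<lambda>s. G s - P t1 * ln s) has_real_derivative P s / s - P t1 * (1 / s)) (at s)"
      using s t1 assms(1) by (auto intro!: derivative_eq_intros G)
    moreover have "P s / s - P t1 * (1 / s) \<le> 0"
      using P_le[OF s] s t1 assms(1) by (simp add: divide_right_mono)
    ultimately show "\<exists>y. ((\<lambda>s. G s - P t1 * ln s) has_real_derivative y) (at s) \<and> y \<le> 0"
      by blast
  qed
  moreover have "ln t = ln t1 + G t1 / - P t1"
    using t1 assms(1) by (simp add: t_def ln_mult)
  moreover have "P t1 * (G t1 / - P t1) = - G t1"
    using t1 by simp
  ultimately have "G t \<le> 0"
    by (simp only: distrib_left)
  with pos[of t] \<open>t1 \<le> t\<close> t1 show False by simp
next
  case False
  then have P_nonneg: "P t \<ge> 0" if "t \<ge> A" for t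
    using that by force
  have G_ge: "G A \<le> G t" if "t \<ge> A" for t
    by (rule DERIV_nonneg_imp_nondecreasing[OF that])
      (use G P_nonneg assms(1) in \<open>force intro!: divide_nonneg_nonneg\<close>)
  have "G A > 0" using pos by simp
  have "P A \<ge> 0" using P_nonneg by simp
  \<comment> \<open>Here the linear bound \<open>P A - G A * (t - A)\<close> equals
    \<open>-1\<close>.\<close>
  define t where "t = A + (P A + 1) / G A"
  have "A \<le> t"
    using \<open>G A > 0\<close> \<open>P A \<ge> 0\<close> by (simp add: t_def)
  have "P t + G A * t \<le> P A + G A * A"
  proof (rule DERIV_nonpos_imp_nonincreasing[OF \<open>A \<le> t\<close>])
    fix s assume s: "A \<le> s"
    have "((\<lambda>s. P s + G A * s) has_real_derivative - G s + G A) (at s)"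
      using s by (auto intro!: derivative_eq_intros P)
    with G_ge[OF s] show "\<exists>y. ((\<lambda>s. P s + G A * s) has_real_derivative y) (at s) \<and> y \<le> 0"
      by force
  qed
  moreover have "G A * t = G A * A + P A + 1"
    using \<open>G A > 0\<close> by (simp add: t_def distrib_left[of _ A])
  ultimately show False
    using P_nonneg[OF \<open>A \<le> t\<close>] by simp
qed

text \<open>Induction on \<open>k\<close>. For \<open>k = 0\<close>, put
  \<open>G t = C_0(-t)\<close> and \<open>P t = t G'(t) = -t C_1(-t)\<close>; the recurrence says
  \<open>P' = -G\<close>, so \<open>G\<close> cannot keep one sign. For the step, Rolle's theorem
  between two zeros of \<open>C_k(-t)\<close> yields a zero of \<open>C_(k+1)(-t)\<close>.\<close>

lemma bessel_clifford_zeros_unbounded: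
  "\<exists>t>M. bessel_clifford k (- t) = (0 :: real)"
proof (induction k arbitrary: M)
  case 0
  show ?case
  proof (rule ccontr)
    assume "\<not> ?thesis"
    then have nz: "bessel_clifford 0 (- t) \<noteq> (0 :: real)" if "t > M" for t
      using that by blast
    define A where "A = max M 0 + 1"
    \<comment> \<open>Multiplying by this sign makes the function positive at \<open>A\<close>,
      hence on the whole half-line by the intermediate value theorem.\<close>
    define \<sigma> where "\<sigma> = sgn (bessel_clifford 0 (- A))"
    have A: "A > 0" "A > M" by (auto simp: A_def)
    have pos: "\<sigma> * bessel_clifford 0 (- t) > 0" if "t \<ge> A" for t
    proof (rule ccontr)
      let ?g = "\<lambda>t. \<sigma> * bessel_clifford 0 (- t)"
      assume "\<not> ?thesis"
      moreover have "?g A > 0"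
        using nz[OF A(2)] by (simp add: \<sigma>_def sgn_if)
      moreover have "continuous_on {A..t} ?g"
        by (intro continuous_intros)
      ultimately have "\<exists>x. A \<le> x \<and> x \<le> t \<and> ?g x = 0"
        using that by (intro IVT2') auto
      then show False
        using nz A by (auto simp: \<sigma>_def sgn_if split: if_splits)
    qed
    have G: "((\<lambda>t. \<sigma> * bessel_clifford 0 (- t)) has_real_derivative
        (- \<sigma> * t * bessel_clifford (Suc 0) (- t)) / t) (at t)" if "t \<ge> A" for t
      by (rule derivative_eq_intros refl | use that A in simp)+
    have P: "((\<lambda>t. - \<sigma> * t * bessel_clifford (Suc 0) (- t)) has_real_derivative
        - (\<sigma> * bessel_clifford 0 (- t))) (at t)" for t
    proof -
      have "((\<lambda>t. - \<sigma> * t * bessel_clifford (Suc 0) (- t)) has_real_derivative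
          - \<sigma> * (- t * bessel_clifford (Suc (Suc 0)) (- t) + of_nat (Suc 0) * bessel_clifford (Suc 0) (- t))) (at t)"
        by (rule derivative_eq_intros refl | simp add: algebra_simps)+
      then show ?thesis
        unfolding bessel_clifford_recurrence by simp
    qed
    show False
      by (rule Bessel_0_no_positive_solution[OF A(1) G P pos])
  qed
next
  case (Suc k)
  obtain t1 where t1: "t1 > M" "bessel_clifford k (- t1) = (0 :: real)"
    using Suc by blast
  obtain t2 where t2: "t2 > t1" "bessel_clifford k (- t2) = (0 :: real)"
    using Suc by blast
  have "((\<lambda>t. bessel_clifford k (- t)) has_real_derivative - bessel_clifford (Suc k) (- t)) (at t)" for t :: real
    by (rule derivative_eq_intros refl | simp)+
  with t1 t2 obtain z where "t1 < z" "- bessel_clifford (Suc k) (- z) = (0 :: real)"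
    using Rolle_DERIV[of t1 t2 "\<lambda>t. bessel_clifford k (- t)" "\<lambda>t. - bessel_clifford (Suc k) (- t)"]
    by auto
  with t1 show ?case
    by (intro exI[of _ z]) auto
qed

lemma bessel_J_zeros_unbounded: "\<exists>x>M. bessel_J k x = 0"
proof -
  \<comment> \<open>The zero of \<open>bessel_J\<close> will be \<open>x = sqrt (4 * t)\<close>, for
    which \<open>x\<^sup>2 / 4 = t\<close>; the maximum covers negative \<open>M\<close>.\<close>
  obtain t where t: "t > (max M 0)\<^sup>2 / 4" "bessel_clifford k (- t) = (0 :: real)"
    using bessel_clifford_zeros_unbounded by blast
  have "(max M 0)\<^sup>2 < 4 * t"
    using t(1) by simp
  then have "max M 0 < sqrt (4 * t)" and "0 \<le> 4 * t"
    by (rule real_less_rsqrt, metis less_imp_le order_trans zero_le_power2)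
  moreover have "bessel_J k (sqrt (4 * t)) = 0"
    using t(2) \<open>0 \<le> 4 * t\<close> by (simp add: bessel_J_eq_bessel_clifford del: real_sqrt_mult)
  ultimately show ?thesis by (intro exI[of _ "sqrt (4 * t)"]) auto
qed

lemma bessel_F_zeros_unbounded: "\<exists>x>M. bessel_F \<kappa> k x = 0"
proof -
  obtain a where a: "a > max M 0" "bessel_J k a = 0"
    using bessel_J_zeros_unbounded by blast
  obtain b where b: "b > a" "bessel_J k b = 0"
    using bessel_J_zeros_unbounded by blast
  let ?\<phi> = "\<lambda>x. bessel_J k x * bessel_J k (\<kappa> / x)"
  have D: "(?\<phi> has_real_derivative - bessel_F \<kappa> k x / x) (at x)" if "x \<ge> a" for x
    using that a by (intro DERIV_bessel_J_mult_inversion) auto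
  have "\<exists>z. a < z \<and> z < b \<and> - bessel_F \<kappa> k z / z = 0"
    using D by (intro Rolle_DERIV[of a b ?\<phi>]) (use a b in auto)
  then obtain z where "a < z" "bessel_F \<kappa> k z = 0"
    using a by auto
  with a show ?thesis by (intro exI[of _ z]) auto
qed

section \<open>Finitely many zeros in compact intervals\<close>

lemma finite_real_zeros_holomorphic:
  assumes "f holomorphic_on S" "open S" "connected S"
    and sub: "of_real ` {a..b} \<subseteq> S" and "w \<in> S" "f w \<noteq> 0"
  shows "finite {x \<in> {a..b}. f (of_real x) = 0}"
proof (rule ccontr)
  let ?Z = "{x \<in> {a..b}. f (of_real x) = 0}" and ?K = "(of_real :: real \<Rightarrow> complex) ` {a..b}"
  assume "infinite ?Z"
  then have "infinite ((of_real :: real \<Rightarrow> complex) ` ?Z)"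
    by (simp add: finite_image_iff inj_on_def)
  moreover have "compact ?K"
    by (intro compact_continuous_image continuous_intros compact_Icc)
  \<comment> \<open>An accumulation point in \<open>?K\<close> lies in \<open>S\<close>, so the
    identity theorem forces \<open>f\<close> to vanish on all of the connected set \<open>S\<close>,
    including \<open>w\<close>.\<close>
  ultimately obtain \<xi> where "\<xi> \<in> ?K" "\<xi> islimpt (of_real ` ?Z)"
    using Heine_Borel_imp_Bolzano_Weierstrass[of ?K "of_real ` ?Z"] by blast
  then have "f w = 0"
    using assms by (intro analytic_continuation[of f S "of_real ` ?Z" \<xi> w]) auto
  with assms show False by simp
qed

lemma finite_bessel_clifford_zeros: "finite {x \<in> {a..b}. bessel_clifford k x = (0 :: real)}"
proof -
  \<comment> \<open>The function is not identically zero, as \<open>C_k(0) = 1/k!\<close>.\<close>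
  have "finite {x \<in> {a..b}. bessel_clifford k (of_real x) = (0 :: complex)}"
    by (rule finite_real_zeros_holomorphic[of _ UNIV _ _ 0])
      (auto intro!: holomorphic_intros simp: bessel_clifford_0)
  then show ?thesis
    by (simp flip: of_real_bessel_clifford)
qed

text \<open>Otherwise \<open>J_k(x) J_k(\<kappa>/x)\<close> is constant on the half-line, and the
  constant is 0 because \<open>J_k\<close> has a positive zero. Then for every \<open>x\<close> in
  \<open>[1,2]\<close> either \<open>x\<close> or \<open>\<kappa>/x\<close> is a zero of
  \<open>J_k\<close>, which leaves only finitely many candidates for \<open>x\<close>.\<close>

lemma bessel_F_not_identically_zero:
  assumes "\<kappa> > 0"
  shows "\<exists>x>0. bessel_F \<kappa> k x \<noteq> 0"
proof (rule ccontr)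
  assume "\<not> ?thesis"
  then have F: "bessel_F \<kappa> k x = 0" if "x > 0" for x
    using that by blast
  let ?\<phi> = "\<lambda>x. bessel_J k x * bessel_J k (\<kappa> / x)"
  obtain j where j: "j > 0" "bessel_J k j = 0"
    using bessel_J_zeros_unbounded by blast
  have "\<exists>c. \<forall>x\<in>{0<..}. ?\<phi> x = c"
  proof (rule has_field_derivative_zero_constant)
    show "(?\<phi> has_real_derivative 0) (at x within {0<..})" if "x \<in> {0<..}" for x
      using DERIV_bessel_J_mult_inversion[of x k \<kappa>] F[of x] that
      by (auto intro: has_field_derivative_at_within)
  qed auto
  then have \<phi>: "?\<phi> x = 0" if "x > 0" for x
    using that j by (metis greaterThan_iff mult_zero_left)
  \<comment> \<open>The interval contains \<open>-x\<^sup>2/4\<close> and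
    \<open>-(\<kappa>/x)\<^sup>2/4\<close> for all \<open>x\<close> in \<open>[1,2]\<close>. The map
    \<open>z \<mapsto> 2 * sqrt (- z)\<close> recovers \<open>x\<close> or \<open>\<kappa>/x\<close>
    from them.\<close>
  define Z where "Z = {x \<in> {- max 1 (\<kappa>\<^sup>2 / 4)..0}. bessel_clifford k x = (0 :: real)}"
  have "{1..2} \<subseteq> (\<lambda>z. 2 * sqrt (- z)) ` Z \<union> (\<lambda>z. \<kappa> / (2 * sqrt (- z))) ` Z"
  proof
    fix x :: real assume x: "x \<in> {1..2}"
    have "x\<^sup>2 \<le> 2\<^sup>2"
      using x by (intro power_mono) auto
    moreover have "(\<kappa> / x)\<^sup>2 \<le> \<kappa>\<^sup>2"
      using x assms by (intro power_mono) (auto simp: divide_le_eq)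
    ultimately have le: "x\<^sup>2 / 4 \<le> max 1 (\<kappa>\<^sup>2 / 4)" "(\<kappa> / x)\<^sup>2 / 4 \<le> max 1 (\<kappa>\<^sup>2 / 4)"
      by (simp_all add: le_max_iff_disj)
    have sqrt: "2 * sqrt (- (- (y\<^sup>2 / 4))) = y" if "y > 0" for y
      using that by (simp add: real_sqrt_divide)
    consider "bessel_J k x = 0" | "bessel_J k (\<kappa> / x) = 0"
      using \<phi>[of x] x by auto
    then show "x \<in> (\<lambda>z. 2 * sqrt (- z)) ` Z \<union> (\<lambda>z. \<kappa> / (2 * sqrt (- z))) ` Z"
    proof cases
      case 1
      then have "- (x\<^sup>2 / 4) \<in> Z"
        using x le(1) by (simp add: Z_def bessel_J_eq_bessel_clifford)
      then show ?thesis
        using sqrt[of x] x by (intro UnI1 image_eqI[of _ _ "- (x\<^sup>2 / 4)"]) auto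
    next
      case 2
      then have "- ((\<kappa> / x)\<^sup>2 / 4) \<in> Z"
        using x le(2) assms by (simp add: Z_def bessel_J_eq_bessel_clifford)
      then show ?thesis
        using sqrt[of "\<kappa> / x"] x assms
        by (intro UnI2 image_eqI[of _ _ "- ((\<kappa> / x)\<^sup>2 / 4)"]) (simp_all only:, auto)
    qed
  qed
  moreover have "finite Z"
    unfolding Z_def by (rule finite_bessel_clifford_zeros)
  ultimately have "finite {1..2 :: real}"
    using finite_subset by blast
  then show False
    using infinite_Icc[of 1 "2 :: real"] by simp
qed

text \<open>The identity theorem is applied on the punctured plane, which is connected;
  \<open>a > 0\<close> keeps the interval inside it.\<close>

lemma finite_bessel_F_zeros:
  assumes "\<kappa> > 0" "a > 0"
  shows "finite {x \<in> {a..b}. bessel_F \<kappa> k x = 0}"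
proof -
  obtain w where w: "w > 0" "bessel_F \<kappa> k w \<noteq> 0"
    using bessel_F_not_identically_zero[OF assms(1)] by blast
  have "finite {x \<in> {a..b}. bessel_F_complex \<kappa> k (of_real x) = 0}"
    by (rule finite_real_zeros_holomorphic[of _ "- {0}" _ _ "of_real w"])
      (use w assms in \<open>auto simp: holomorphic_bessel_F_complex bessel_F_complex_of_real
        connected_punctured_universe\<close>)
  also have "{x \<in> {a..b}. bessel_F_complex \<kappa> k (of_real x) = 0} = {x \<in> {a..b}. bessel_F \<kappa> k x = 0}"
    using assms by (auto simp: bessel_F_complex_of_real)
  finally show ?thesis .
qed

section \<open>Indexing the zeros by the integers\<close>

lemma locally_finite_real_enumeration:
  fixes Z :: "real set"
  assumes "infinite Z" and fin: "\<And>b. finite (Z \<inter> {..b})"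
  shows "\<exists>a :: nat \<Rightarrow> real. strict_mono a \<and> range a = Z"
proof -
  \<comment> \<open>The rank of \<open>z\<close> in \<open>Z\<close> is finite and strictly
    increasing, so \<open>Z\<close> can be listed by pulling back the increasing enumeration of the
    infinite set of ranks.\<close>
  define r where "r z = card (Z \<inter> {..<z})" for z
  have r_less: "r z < r z'" if "z \<in> Z" "z < z'" for z z'
    unfolding r_def
  proof (rule psubset_card_mono)
    show "finite (Z \<inter> {..<z'})"
      by (rule finite_subset[OF _ fin[of z']]) auto
  qed (use that in auto)
  then have inj: "inj_on r Z"
    by (metis inj_onI linorder_less_linear less_irrefl)
  with assms(1) have inf: "infinite (r ` Z)"
    by (simp add: finite_image_iff)
  define a where "a n = the_inv_into Z r (enumerate (r ` Z) n)" for n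
  have range_enum: "range (enumerate (r ` Z)) = r ` Z"
    by (rule range_enumerate[OF inf])
  have a_in: "a n \<in> Z" and r_a: "r (a n) = enumerate (r ` Z) n" for n
    unfolding a_def using inj enumerate_in_set[OF inf, of n]
    by (auto simp: the_inv_into_into f_the_inv_into_f)
  have "strict_mono a"
  proof (rule strict_monoI, rule ccontr)
    fix m n :: nat assume "m < n" "\<not> a m < a n"
    then have "r (a n) \<le> r (a m)"
      using r_less[OF a_in, of n "a m"] by (cases "a n = a m") auto
    with enumerate_mono[OF \<open>m < n\<close> inf] show False
      by (simp add: r_a)
  qed
  moreover have "range a = Z"
    using range_enum the_inv_into_onto[OF inj] unfolding a_def
    by (metis (no_types) image_image)
  ultimately show ?thesis by blast
qed

lemma bessel_F_zeros_enumeration: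
  assumes "\<kappa> > 0"
  shows "\<exists>\<alpha> :: int \<Rightarrow> real.
    strict_mono \<alpha> \<and> range \<alpha> = {x. x > 0 \<and> bessel_F \<kappa> k x = 0} \<and>
    (\<forall>l. \<alpha> (- l) = \<kappa> / \<alpha> l) \<and> \<alpha> 0 = sqrt \<kappa> \<and>
    filterlim \<alpha> at_top at_top \<and> (\<alpha> \<longlongrightarrow> 0) at_bot"
proof -
  let ?s = "sqrt \<kappa>"
  have s: "?s > 0" "?s * ?s = \<kappa>" "\<kappa> / ?s = ?s"
    using assms by (auto simp: real_div_sqrt)
  define Z where "Z = {x. x \<ge> ?s \<and> bessel_F \<kappa> k x = 0}"
  have unbounded: "\<exists>z\<in>Z. z > M" for M
    using bessel_F_zeros_unbounded[of "max M ?s" \<kappa> k] less_imp_le by (fastforce simp: Z_def)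
  have "infinite Z"
    using unbounded by (metis Max_ge leD)
  moreover have "finite (Z \<inter> {..b})" for b
    using finite_bessel_F_zeros[OF assms s(1), of b k]
    by (rule rev_finite_subset) (auto simp: Z_def)
  ultimately obtain a :: "nat \<Rightarrow> real" where a: "strict_mono a" "range a = Z"
    using locally_finite_real_enumeration by blast
  have a_ge: "a n \<ge> ?s" and a_zero: "bessel_F \<kappa> k (a n) = 0" for n
    using a(2) by (auto simp: Z_def)
  have a_less: "a m < a n \<longleftrightarrow> m < n" for m n
    using a(1) by (rule strict_mono_less)
  \<comment> \<open>The inversion fixes \<open>?s\<close>, so the value there equals its own
    negative.\<close>
  have "bessel_F \<kappa> k ?s = 0"
    using bessel_F_inversion[of \<kappa> k ?s] assms s(3) by simp
  then have "?s \<in> range a"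
    using a(2) by (simp add: Z_def)
  \<comment> \<open>\<open>?s\<close> is the least element of \<open>Z\<close>, hence the first term
    of the increasing sequence.\<close>
  then have a0: "a 0 = ?s"
    using a_ge[of 0] a_less by (metis imageE le_zero_eq not_le_imp_less order.strict_iff_not order_antisym_conv)
  have a_pos: "a n > 0" for n
    using a_ge[of n] s by linarith
  \<comment> \<open>The two branches agree at \<open>l = 0\<close> because
    \<open>\<kappa> / ?s = ?s\<close>; thus the reflection law holds there too.\<close>
  define \<alpha> where "\<alpha> l = (if l \<ge> 0 then a (nat l) else \<kappa> / a (nat (- l)))" for l :: int
  have pos: "\<alpha> l > 0" for l
    using assms a_pos by (simp add: \<alpha>_def)
  have refl: "\<alpha> (- l) = \<kappa> / \<alpha> l" for l
    using assms a_pos s(3) a0 by (cases l "0 :: int" rule: linorder_cases) (simp_all add: \<alpha>_def)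
  have mono_nonneg: "\<alpha> l < \<alpha> m" if "0 \<le> l" "l < m" for l m
    using that by (simp add: \<alpha>_def a_less)
  have ge: "\<alpha> l \<ge> ?s" if "l \<ge> 0" for l
    using that a_ge by (simp add: \<alpha>_def)
  have less: "\<alpha> l < ?s" if "l < 0" for l
  proof -
    have "?s < \<alpha> (- l)"
      using mono_nonneg[of 0 "- l"] that a0 by (simp add: \<alpha>_def)
    then have "\<kappa> / \<alpha> (- l) < \<kappa> / ?s"
      using assms s(1) pos by (intro divide_strict_left_mono mult_pos_pos) auto
    then show ?thesis
      using refl[of "- l"] s by simp
  qed
  have mono: "strict_mono \<alpha>"
  proof (rule strict_monoI)
    fix l m :: int assume "l < m"
    consider "0 \<le> l" | "l < 0" "0 \<le> m" | "m < 0" by linarith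
    then show "\<alpha> l < \<alpha> m"
    proof cases
      case 1
      then show ?thesis using \<open>l < m\<close> by (rule mono_nonneg)
    next
      case 2
      then show ?thesis using less[of l] ge[of m] by simp
    next
      case 3
      then have "\<alpha> (- m) < \<alpha> (- l)"
        using \<open>l < m\<close> by (intro mono_nonneg) auto
      then have "\<kappa> / \<alpha> (- l) < \<kappa> / \<alpha> (- m)"
        using assms pos by (intro divide_strict_left_mono) auto
      then show ?thesis
        using refl[of "- l"] refl[of "- m"] by simp
    qed
  qed
  have zero: "bessel_F \<kappa> k (\<alpha> l) = 0" for l
    using assms a_zero bessel_F_inversion[of \<kappa> k] by (simp add: \<alpha>_def)
  have "x \<in> range \<alpha>" if "x > 0" "bessel_F \<kappa> k x = 0" for x
  proof (cases "x \<ge> ?s")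
    case True
    with that have "x \<in> range a"
      unfolding a(2) Z_def by simp
    then obtain n where "x = a n" by blast
    then have "x = \<alpha> (int n)" by (simp add: \<alpha>_def)
    then show ?thesis by blast
  next
    case False
    then have "?s * x \<le> ?s * ?s"
      using s(1) by (intro mult_left_mono) auto
    then have "?s \<le> \<kappa> / x"
      unfolding s(2) using that by (simp add: pos_le_divide_eq)
    then have "\<kappa> / x \<in> range a"
      using that a(2) assms bessel_F_inversion[of \<kappa> k x] by (simp add: Z_def)
    then obtain n where "\<kappa> / x = \<alpha> (int n)"
      by (auto simp: \<alpha>_def)
    then have "x = \<alpha> (- int n)"
      using refl[of "int n"] that assms by (metis div_by_0 divide_divide_eq_right less_irrefl nonzero_mult_div_cancel_left)
    then show ?thesis by blast
  qed
  then have range: "range \<alpha> = {x. x > 0 \<and> bessel_F \<kappa> k x = 0}"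
    using pos zero by auto
  have large: "\<exists>N. \<forall>l\<ge>N. \<alpha> l > M" for M
  proof -
    obtain n where "a n > M"
      using unbounded a(2) by blast
    then have "\<alpha> (int n) > M" by (simp add: \<alpha>_def)
    then show ?thesis
      using mono by (metis order_less_le_trans strict_mono_less_eq)
  qed
  have "filterlim \<alpha> at_top at_top"
    unfolding filterlim_at_top eventually_at_top_linorder by (meson large less_imp_le)
  moreover have "(\<alpha> \<longlongrightarrow> 0) at_bot"
  proof (rule tendstoI)
    fix e :: real assume "e > 0"
    obtain N where N: "\<And>l. l \<ge> N \<Longrightarrow> \<alpha> l > \<kappa> / e"
      using large by blast
    \<comment> \<open>The reflection turns a large value at \<open>- l\<close> into a small one at
      \<open>l\<close>.\<close>
    have "\<alpha> l < e" if "l \<le> - N" for l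
      using N[of "- l"] that refl[of l] pos[of l] \<open>e > 0\<close> assms
      by (simp add: field_simps)
    then show "\<forall>\<^sub>F l in at_bot. dist (\<alpha> l) 0 < e"
      unfolding eventually_at_bot_linorder using pos by (auto simp: less_imp_le)
  qed
  moreover have "\<alpha> 0 = ?s"
    by (simp add: \<alpha>_def a0)
  ultimately show ?thesis
    using mono range refl by blast
qed

section \<open>A class of smooth functions closed under partial derivatives\<close>

text \<open>Differentiating a radial generator raises \<open>j\<close> by one and brings out a
  linear factor \<open>2 * a * (x \<bullet> b)\<close>; hence all \<open>j\<close> and all linear
  maps are included. Membership then gives \<open>C_closure\<close> of every order without computing
  higher derivatives.\<close>

inductive_set clifford_algebra :: "('a::euclidean_space \<Rightarrow> complex) set" where
  const: "(\<lambda>x. c) \<in> clifford_algebra"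
| linear: "bounded_linear f \<Longrightarrow> f \<in> clifford_algebra"
| radial: "(\<lambda>x. bessel_clifford j (of_real (a * (x \<bullet> x)))) \<in> clifford_algebra"
| add: "f \<in> clifford_algebra \<Longrightarrow> g \<in> clifford_algebra \<Longrightarrow> (\<lambda>x. f x + g x) \<in> clifford_algebra"
| mult: "f \<in> clifford_algebra \<Longrightarrow> g \<in> clifford_algebra \<Longrightarrow> (\<lambda>x. f x * g x) \<in> clifford_algebra"

lemma partial_deriv_eq:
  "(u has_derivative u') (at x) \<Longrightarrow> partial_deriv b u x = u' b"
  unfolding partial_deriv_def by (metis frechet_derivative_at)

lemma has_derivative_partial_deriv:
  "u differentiable (at x) \<Longrightarrow> (u has_derivative (\<lambda>b. partial_deriv b u x)) (at x)"
  by (simp add: partial_deriv_def frechet_derivative_works)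

lemma partial_deriv_add:
  assumes "\<And>x. f differentiable (at x)" "\<And>x. g differentiable (at x)"
  shows "partial_deriv b (\<lambda>x. f x + g x) = (\<lambda>x. partial_deriv b f x + partial_deriv b g x)"
  by (rule ext, rule partial_deriv_eq[OF has_derivative_add])
    (rule has_derivative_partial_deriv assms)+

lemma partial_deriv_mult:
  fixes f g :: "'a::euclidean_space \<Rightarrow> 'b::real_normed_algebra"
  assumes "\<And>x. f differentiable (at x)" "\<And>x. g differentiable (at x)"
  shows "partial_deriv b (\<lambda>x. f x * g x) = (\<lambda>x. f x * partial_deriv b g x + partial_deriv b f x * g x)"
  by (rule ext, rule partial_deriv_eq[OF has_derivative_mult])
    (rule has_derivative_partial_deriv assms)+

lemma partial_deriv_cmult:
  fixes f :: "'a::euclidean_space \<Rightarrow> 'b::real_normed_algebra"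
  assumes "\<And>x. f differentiable (at x)"
  shows "partial_deriv b (\<lambda>x. c * f x) = (\<lambda>x. c * partial_deriv b f x)"
  by (rule ext, rule partial_deriv_eq[OF has_derivative_mult_right])
    (rule has_derivative_partial_deriv assms)+

lemma has_derivative_radial_bessel_clifford [derivative_intros]:
  "((\<lambda>x::'a::euclidean_space. bessel_clifford j (of_real (a * (x \<bullet> x))) :: complex) has_derivative
     (\<lambda>h. of_real (2 * a * (x \<bullet> h)) * bessel_clifford (Suc j) (of_real (a * (x \<bullet> x))))) (at x)"
proof -
  have "((\<lambda>x::'a. of_real (a * (x \<bullet> x)) :: complex) has_derivative
      (\<lambda>h. of_real (2 * a * (x \<bullet> h)))) (at x)"
    by (auto intro!: derivative_eq_intros simp: inner_commute algebra_simps)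
  from has_derivative_compose[OF this
      has_field_derivative_bessel_clifford[unfolded has_field_derivative_def]]
  show ?thesis by (simp add: mult.commute)
qed

text \<open>Both claims go through one induction, since the sum and product rules need the
  differentiability of the parts.\<close>

lemma clifford_algebra_partial_deriv:
  assumes "f \<in> clifford_algebra"
  shows "(\<forall>x. f differentiable (at x)) \<and> partial_deriv b f \<in> clifford_algebra"
  using assms
proof induction
  case (const c)
  have "partial_deriv b (\<lambda>x::'a. c) = (\<lambda>x. 0)"
    by (rule ext, subst partial_deriv_eq) (rule derivative_intros refl)+
  then show ?case by (simp add: clifford_algebra.const)
next
  case (linear f)
  then have "partial_deriv b f = (\<lambda>x. f b)"
    by (intro ext partial_deriv_eq bounded_linear_imp_has_derivative)
  with linear show ?case
    by (auto simp: clifford_algebra.const bounded_linear_imp_differentiable)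
next
  case (radial j a)
  have "partial_deriv b (\<lambda>x::'a. bessel_clifford j (of_real (a * (x \<bullet> x))) :: complex)
      = (\<lambda>x. of_real (2 * a * (x \<bullet> b)) * bessel_clifford (Suc j) (of_real (a * (x \<bullet> x))))"
    by (intro ext partial_deriv_eq has_derivative_radial_bessel_clifford)
  moreover have "(\<lambda>x::'a. of_real (2 * a * (x \<bullet> b)) :: complex) \<in> clifford_algebra"
    by (intro clifford_algebra.linear bounded_linear_compose[OF bounded_linear_of_real]
        bounded_linear_const_mult bounded_linear_inner_left)
  ultimately have "partial_deriv b (\<lambda>x::'a. bessel_clifford j (of_real (a * (x \<bullet> x))) :: complex) \<in> clifford_algebra"
    by (simp only: clifford_algebra.mult clifford_algebra.radial)
  then show ?case
    using differentiableI[OF has_derivative_radial_bessel_clifford] by blast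
next
  case (add f g)
  then have "partial_deriv b (\<lambda>x. f x + g x) = (\<lambda>x. partial_deriv b f x + partial_deriv b g x)"
    by (intro partial_deriv_add) blast+
  with add show ?case
    by (metis clifford_algebra.add differentiable_add)
next
  case (mult f g)
  then have "partial_deriv b (\<lambda>x. f x * g x) = (\<lambda>x. f x * partial_deriv b g x + partial_deriv b f x * g x)"
    by (intro partial_deriv_mult) blast+
  then have "partial_deriv b (\<lambda>x. f x * g x) \<in> clifford_algebra"
    using mult by (simp only: clifford_algebra.add clifford_algebra.mult)
  then show ?case
    using mult differentiable_mult by blast
qed

lemma clifford_algebra_iterated_partial:
  "f \<in> clifford_algebra \<Longrightarrow> iterated_partial bs f \<in> clifford_algebra"
  by (induction bs) (auto simp: clifford_algebra_partial_deriv)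

lemma clifford_algebra_continuous_on:
  "f \<in> clifford_algebra \<Longrightarrow> continuous_on A f"
  using clifford_algebra_partial_deriv
  by (metis continuous_on_eq_continuous_within differentiable_imp_continuous_within
      differentiable_at_withinI)

text \<open>Iterated partial derivatives stay in the algebra and are continuous on the whole space,
  so each serves as its own extension to the closure.\<close>

lemma clifford_algebra_C_closure:
  assumes "f \<in> clifford_algebra"
  shows "C_closure n S f"
  unfolding C_closure_def
  using clifford_algebra_iterated_partial[OF assms] clifford_algebra_partial_deriv
    clifford_algebra_continuous_on assms
  by blast

lemma clifford_algebra_power:
  "f \<in> clifford_algebra \<Longrightarrow> (\<lambda>x. f x ^ n) \<in> clifford_algebra"
  by (induction n) (auto intro: clifford_algebra.intros)

lemma clifford_algebra_cmult:
  "f \<in> clifford_algebra \<Longrightarrow> (\<lambda>x. c * f x) \<in> clifford_algebra"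
  by (rule clifford_algebra.mult[OF clifford_algebra.const])

section \<open>Eigenfunctions\<close>

definition to_complex :: "real ^ 2 \<Rightarrow> complex" where
  "to_complex x = Complex (x $ 1) (x $ 2)"

lemma bounded_linear_to_complex: "bounded_linear to_complex"
proof -
  have "to_complex = (\<lambda>x. of_real (x $ 1) + \<i> * of_real (x $ 2))"
    by (simp add: to_complex_def complex_eq_iff fun_eq_iff)
  show ?thesis
    unfolding \<open>to_complex = _\<close>
    by (intro bounded_linear_add bounded_linear_const_mult
        bounded_linear_compose[OF bounded_linear_of_real bounded_linear_vec_nth])
qed

text \<open>This is \<open>J_k(\<alpha>r) e^(ik\<theta>)\<close> with
  \<open>r^k e^(ik\<theta>)\<close> gathered into a power of the complex coordinate, which avoids
  \<open>norm\<close> and \<open>Arg\<close>, not smooth at the origin.\<close>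

definition cylinder_wave :: "nat \<Rightarrow> real \<Rightarrow> real ^ 2 \<Rightarrow> complex" where
  "cylinder_wave k \<alpha> x =
     (of_real (\<alpha> / 2) * to_complex x) ^ k * bessel_clifford k (of_real (- (\<alpha>\<^sup>2 / 4) * (x \<bullet> x)))"

lemma cylinder_wave_in_clifford_algebra: "cylinder_wave k \<alpha> \<in> clifford_algebra"
  unfolding cylinder_wave_def[abs_def]
  by (intro clifford_algebra_power clifford_algebra_cmult clifford_algebra.mult
      clifford_algebra.radial clifford_algebra.linear bounded_linear_to_complex)

lemma laplacian_linear:
  assumes "f \<in> clifford_algebra" "g \<in> clifford_algebra"
  shows "laplacian (\<lambda>x. c * f x + d * g x) = (\<lambda>x. c * laplacian f x + d * laplacian g x)"
  using assms
  by (simp add: laplacian_def[abs_def] partial_deriv_add partial_deriv_cmult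
      clifford_algebra_cmult clifford_algebra_partial_deriv sum.distrib sum_distrib_left)

lemma sum_Basis_real2:
  fixes f :: "real ^ 2 \<Rightarrow> 'a::comm_monoid_add"
  shows "(\<Sum>b\<in>Basis. f b) = f (axis 1 1) + f (axis 2 1)"
proof -
  have Basis: "(Basis :: (real ^ 2) set) = {axis 1 1, axis 2 1}"
    by (auto simp: Basis_vec_def UNIV_2)
  have "axis 1 1 \<noteq> (axis 2 1 :: real ^ 2)"
    by (simp add: axis_eq_axis)
  then show ?thesis
    unfolding Basis by (subst sum.insert) auto
qed

lemma to_complex_axis: "to_complex (axis 1 t) = of_real t" "to_complex (axis 2 t) = \<i> * of_real t"
  by (simp_all add: to_complex_def axis_def complex_eq_iff)

lemma has_derivative_to_complex [derivative_intros]: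
  "(to_complex has_derivative to_complex) (at x within A)"
  by (intro bounded_linear_imp_has_derivative bounded_linear_to_complex)

text \<open>Write the wave as \<open>A z^k C_k(a |x|\<^sup>2)\<close>. The factor \<open>z^k\<close>
  is harmonic, the cross term contributes \<open>k\<close> by homogeneity, and the remaining terms
  are \<open>4a = -\<alpha>\<^sup>2\<close> times the left side of
  \<open>bessel_clifford_recurrence\<close>.\<close>

lemma laplacian_cylinder_wave:
  "laplacian (cylinder_wave k \<alpha>) x = - of_real (\<alpha>\<^sup>2) * cylinder_wave k \<alpha> x"
proof -
  define a where "a = - (\<alpha>\<^sup>2 / 4)"
  define C where "C j x = (bessel_clifford j (of_real (a * (x \<bullet> x))) :: complex)" for j and x :: "real^2"
  let ?z = to_complex
  define A :: complex where "A = of_real (\<alpha> / 2) ^ k"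
  have w: "cylinder_wave k \<alpha> = (\<lambda>x. A * (?z x ^ k * C k x))"
    by (simp add: cylinder_wave_def[abs_def] C_def a_def A_def power_mult_distrib power_divide mult.assoc fun_eq_iff)
  have dC: "(C j has_derivative (\<lambda>h. of_real (2 * a * (x \<bullet> h)) * C (Suc j) x)) (at x)" for j x
    unfolding C_def[abs_def] by (rule has_derivative_radial_bessel_clifford)
  have d1: "partial_deriv b (cylinder_wave k \<alpha>)
    = (\<lambda>x. A * (of_nat k * ?z x ^ (k - 1) * ?z b * C k x + ?z x ^ k * (of_real (2 * a * (x \<bullet> b)) * C (Suc k) x)))" for b
    unfolding w
    by (rule ext, rule partial_deriv_eq[THEN trans])
      (rule derivative_intros dC refl | simp add: algebra_simps)+
  \<comment> \<open>Grouped by the factors that depend on \<open>b\<close>; their sums over the two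
    axes are \<open>1 + \<i>\<^sup>2 = 0\<close>, \<open>?z x\<close>, \<open>2\<close> and
    \<open>x \<bullet> x\<close>.\<close>
  have d2: "partial_deriv b (partial_deriv b (cylinder_wave k \<alpha>)) x
    = A * (of_nat k * of_nat (k - 1) * ?z x ^ (k - 1 - 1) * C k x * (?z b)\<^sup>2
        + 4 * a * (of_nat k * ?z x ^ (k - 1)) * C (Suc k) x * (of_real (x \<bullet> b) * ?z b)
        + ?z x ^ k * (2 * a * C (Suc k) x * of_real (b \<bullet> b) + 4 * a\<^sup>2 * C (Suc (Suc k)) x * of_real ((x \<bullet> b)\<^sup>2)))" for b
    unfolding d1
    by (rule partial_deriv_eq[THEN trans])
      (rule derivative_intros dC refl | simp add: algebra_simps power2_eq_square)+
  have z: "of_real (x $ 1) + \<i> * of_real (x $ 2) = ?z x"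
    by (simp add: to_complex_def complex_eq_iff)
  have s: "x \<bullet> x = (x $ 1)\<^sup>2 + (x $ 2)\<^sup>2"
    by (simp add: inner_vec_def sum_2 power2_eq_square)
  \<comment> \<open>For \<open>k = 0\<close> the truncated exponent \<open>k - 1\<close> is harmless
    thanks to the factor \<open>of_nat k\<close>.\<close>
  have zk: "of_nat k * ?z x ^ (k - 1) * ?z x = of_nat k * ?z x ^ k"
    by (cases k) simp_all
  have rec: "of_real (a * (x \<bullet> x)) * C (Suc (Suc k)) x + of_nat (Suc k) * C (Suc k) x = C k x"
    unfolding C_def by (rule bessel_clifford_recurrence)
  have "laplacian (cylinder_wave k \<alpha>) x
    = A * (of_nat k * of_nat (k - 1) * ?z x ^ (k - 1 - 1) * C k x * (1 + \<i>\<^sup>2)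
        + 4 * a * (of_nat k * ?z x ^ (k - 1)) * C (Suc k) x * (of_real (x $ 1) + \<i> * of_real (x $ 2))
        + ?z x ^ k * (4 * a * C (Suc k) x + 4 * a\<^sup>2 * C (Suc (Suc k)) x * of_real (x \<bullet> x)))"
    unfolding laplacian_def sum_Basis_real2 d2 s
    by (simp add: to_complex_axis inner_axis inner_axis_axis algebra_simps)
  also have "\<dots> = A * (4 * a * C (Suc k) x * (of_nat k * ?z x ^ (k - 1) * ?z x)
        + ?z x ^ k * (4 * a * C (Suc k) x + 4 * a\<^sup>2 * C (Suc (Suc k)) x * of_real (x \<bullet> x)))"
    unfolding z by simp
  also have "\<dots> = A * 4 * a * ?z x ^ k *
      (of_real (a * (x \<bullet> x)) * C (Suc (Suc k)) x + of_nat (Suc k) * C (Suc k) x)"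
    unfolding zk by (simp add: algebra_simps power2_eq_square)
  also have "\<dots> = - of_real (\<alpha>\<^sup>2) * cylinder_wave k \<alpha> x"
    unfolding rec w by (simp add: a_def)
  finally show ?thesis .
qed

section \<open>Polar form and boundary conditions\<close>

lemma cmod_to_complex: "cmod (to_complex x) = norm x"
  by (simp add: to_complex_def cmod_def norm_vec_def L2_set_def sum_2)

text \<open>Take the \<open>k\<close>-th power of the polar form of \<open>to_complex x\<close>. The
  origin is no exception: for \<open>k > 0\<close> both sides vanish, for \<open>k = 0\<close> the
  exponential is 1.\<close>

lemma polar_mode_bessel_J:
  "of_real (bessel_J k (\<alpha> * norm x)) * exp (\<i> * of_nat k * of_real (Arg (to_complex x)))
    = cylinder_wave k \<alpha> x"
proof -
  have "of_real (norm x) * exp (\<i> * of_real (Arg (to_complex x))) = to_complex x"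
    using rcis_cmod_Arg[of "to_complex x"]
    by (simp add: rcis_def cis_conv_exp cmod_to_complex)
  then have "to_complex x ^ k = of_real (norm x) ^ k * exp (\<i> * of_real (Arg (to_complex x))) ^ k"
    by (metis power_mult_distrib)
  also have "exp (\<i> * of_real (Arg (to_complex x))) ^ k = exp (\<i> * of_nat k * of_real (Arg (to_complex x)))"
    by (simp add: exp_of_nat_mult[symmetric] mult_ac)
  finally show ?thesis
    by (simp add: cylinder_wave_def bessel_J_eq_bessel_clifford of_real_bessel_clifford
        power_mult_distrib power_divide dot_square_norm mult_ac)
qed

lemma polar_mode_eq_cylinder_wave:
  "polar_mode k (\<lambda>r. c * of_real (bessel_J k (\<alpha> * r)) + d * of_real (bessel_J k (\<beta> * r)))
    = (\<lambda>x. c * cylinder_wave k \<alpha> x + d * cylinder_wave k \<beta> x)"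
  unfolding polar_mode_bessel_J[symmetric]
  by (simp only: polar_mode_def to_complex_def distrib_right mult.assoc fun_eq_iff simp_thms)

text \<open>Along a ray the wave is a constant times its radial profile, so both boundary conditions
  become conditions on the profile at \<open>r = 1\<close>.\<close>

lemma cylinder_wave_scaleR:
  assumes "norm x = 1"
  shows "cylinder_wave k \<alpha> (r *\<^sub>R x) = to_complex x ^ k * of_real (bessel_J k (\<alpha> * r))"
proof -
  have "x \<bullet> x = 1"
    using assms by (simp add: dot_square_norm)
  moreover have "to_complex (r *\<^sub>R x) = of_real r * to_complex x"
    using linear_scale[OF bounded_linear.linear[OF bounded_linear_to_complex]]
    by (simp add: scaleR_conv_of_real)
  ultimately show ?thesis
    by (simp add: cylinder_wave_def bessel_J_eq_bessel_clifford of_real_bessel_clifford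
        power_mult_distrib power_divide power2_eq_square mult_ac)
qed

text \<open>On the first wave the equation reads \<open>\<alpha>^4 + \<alpha>\<^sup>2
  \<beta>\<^sup>2 = (\<alpha>\<^sup>2 + \<beta>\<^sup>2) \<alpha>\<^sup>2\<close>, and symmetrically
  on the second. The boundary conditions are the two linear equations multiplied by
  \<open>to_complex x ^ k\<close>.\<close>

lemma clamped_solution_cylinder_wave:
  assumes "\<kappa> = \<alpha> * \<beta>"
    and dirichlet: "c * of_real (bessel_J k \<alpha>) + d * of_real (bessel_J k \<beta>) = 0"
    and neumann: "c * of_real (\<alpha> * deriv (bessel_J k) \<alpha>) + d * of_real (\<beta> * deriv (bessel_J k) \<beta>) = 0"
  shows "clamped_solution \<kappa> (\<alpha>\<^sup>2 + \<beta>\<^sup>2) (\<lambda>x. c * cylinder_wave k \<alpha> x + d * cylinder_wave k \<beta> x)"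
  unfolding clamped_solution_def
proof (intro conjI ballI)
  let ?u = "\<lambda>x. c * cylinder_wave k \<alpha> x + d * cylinder_wave k \<beta> x"
  show "C_closure 4 D1 ?u"
    by (intro clifford_algebra_C_closure clifford_algebra.add clifford_algebra_cmult
        cylinder_wave_in_clifford_algebra)
  have "laplacian ?u = (\<lambda>x. (- of_real (\<alpha>\<^sup>2) * c) * cylinder_wave k \<alpha> x + (- of_real (\<beta>\<^sup>2) * d) * cylinder_wave k \<beta> x)"
    by (simp add: laplacian_linear cylinder_wave_in_clifford_algebra laplacian_cylinder_wave mult_ac)
  then show "laplacian (laplacian ?u) x + of_real (\<kappa>\<^sup>2) * ?u x = - of_real (\<alpha>\<^sup>2 + \<beta>\<^sup>2) * laplacian ?u x" for x
    by (simp only: laplacian_linear cylinder_wave_in_clifford_algebra laplacian_cylinder_wave)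
      (simp add: assms(1) power_mult_distrib algebra_simps)
next
  fix x :: "real ^ 2"
  assume "x \<in> frontier D1"
  then have x: "norm x = 1" by simp
  have wave: "c * cylinder_wave k \<alpha> (r *\<^sub>R x) + d * cylinder_wave k \<beta> (r *\<^sub>R x)
      = to_complex x ^ k * (c * of_real (bessel_J k (\<alpha> * r)) + d * of_real (bessel_J k (\<beta> * r)))" for r
    unfolding cylinder_wave_scaleR[OF x] by (simp add: algebra_simps)
  show "c * cylinder_wave k \<alpha> x + d * cylinder_wave k \<beta> x = 0"
    using wave[of 1] dirichlet by simp
  have J: "((\<lambda>r. of_real (bessel_J k (\<alpha> * r)) :: complex) has_vector_derivative
      of_real (\<alpha> * deriv (bessel_J k) \<alpha>)) (at 1 within {0..1})" for \<alpha>
  proof (rule has_vector_derivative_at_within, rule has_vector_derivative_of_real)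
    show "((\<lambda>r. bessel_J k (\<alpha> * r)) has_real_derivative \<alpha> * deriv (bessel_J k) \<alpha>) (at 1)"
      by (rule DERIV_cong[OF DERIV_chain2[OF DERIV_bessel_J]])
        (rule derivative_eq_intros refl | simp)+
  qed
  have "((\<lambda>r. to_complex x ^ k * (c * of_real (bessel_J k (\<alpha> * r)) + d * of_real (bessel_J k (\<beta> * r))))
      has_vector_derivative
      to_complex x ^ k * (c * of_real (\<alpha> * deriv (bessel_J k) \<alpha>) + d * of_real (\<beta> * deriv (bessel_J k) \<beta>)))
      (at 1 within {0..1})"
    by (intro has_vector_derivative_mult_right has_vector_derivative_add J)
  then show "((\<lambda>r. c * cylinder_wave k \<alpha> (r *\<^sub>R x) + d * cylinder_wave k \<beta> (r *\<^sub>R x))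
      has_vector_derivative 0) (at 1 within {0..1})"
    unfolding neumann wave by simp
qed

text \<open>Restrict to the points \<open>(sqrt s, 0)\<close> and divide by
  \<open>(sqrt s / 2)^k\<close>. If the resulting function of \<open>s\<close> vanishes on
  \<open>(0,1)\<close>, so does its derivative; their limits at 0 give \<open>p + q = 0\<close> and
  \<open>p \<alpha>\<^sup>2 + q \<beta>\<^sup>2 = 0\<close>, a Vandermonde system with
  \<open>\<alpha>\<^sup>2 \<noteq> \<beta>\<^sup>2\<close>.\<close>

lemma cylinder_wave_independent:
  assumes "\<alpha> > 0" "\<beta> > 0" "\<alpha> \<noteq> \<beta>" "(c, d) \<noteq> (0, 0)"
  shows "\<exists>x\<in>D1. c * cylinder_wave k \<alpha> x + d * cylinder_wave k \<beta> x \<noteq> 0"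
proof (rule ccontr)
  assume "\<not> ?thesis"
  then have "\<forall>x\<in>D1. c * cylinder_wave k \<alpha> x + d * cylinder_wave k \<beta> x = 0"
    by (simp only: bex_simps not_not)
  note zero = this[rule_format]
  \<comment> \<open>\<open>h 0\<close> is the restricted function and \<open>h 1\<close> is
    \<open>-4\<close> times its derivative; the chain rule supplies the additional
    \<open>\<alpha>\<^sup>2\<close> and \<open>\<beta>\<^sup>2\<close>.\<close>
  define h where "h j s = c * of_real \<alpha> ^ (k + 2 * j) * of_real (bessel_clifford (k + j) (- (\<alpha>\<^sup>2 / 4) * s))
      + d * of_real \<beta> ^ (k + 2 * j) * of_real (bessel_clifford (k + j) (- (\<beta>\<^sup>2 / 4) * s))" for j and s :: real
  have cont: "continuous_on {0..1} (h j)" for j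
    unfolding h_def[abs_def] by (intro continuous_intros)
  have h0: "h 0 s = 0" if "s \<in> {0<..<1}" for s
  proof -
    have "norm (axis 1 (sqrt s) :: real ^ 2) < 1"
      using that by (simp add: norm_eq_sqrt_inner inner_axis_axis)
    then have "c * cylinder_wave k \<alpha> (axis 1 (sqrt s)) + d * cylinder_wave k \<beta> (axis 1 (sqrt s)) = 0"
      by (intro zero) simp
    moreover have "cylinder_wave k \<alpha> (axis 1 (sqrt s))
        = of_real (sqrt s / 2) ^ k * (of_real \<alpha> ^ k * of_real (bessel_clifford k (- (\<alpha>\<^sup>2 / 4) * s)))" for \<alpha>
      using that
      by (simp add: cylinder_wave_def to_complex_axis inner_axis_axis
          of_real_bessel_clifford power_mult_distrib power_divide)
    ultimately have "of_real (sqrt s / 2) ^ k * h 0 s = 0"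
      by (simp add: h_def algebra_simps)
    then show ?thesis
      using that by simp
  qed
  have h1: "h 1 s = 0" if s: "s \<in> {0<..<1}" for s
  proof -
    have "(h 0 has_vector_derivative (- 1 / 4) * h 1 s) (at s)"
      unfolding h_def[abs_def]
      by (rule derivative_eq_intros refl | simp)+
        (simp add: algebra_simps power_add power2_eq_square)
    moreover have "(h 0 has_vector_derivative 0) (at s)"
      by (rule has_vector_derivative_transform_within_open[of "\<lambda>_. 0" 0 s "{0<..<1}"])
        (use s h0 in auto)
    ultimately have "(- 1 / 4) * h 1 s = 0"
      by (rule vector_derivative_unique_at)
    then show ?thesis by simp
  qed
  have at_0: "h j 0 = 0" if "\<And>s. s \<in> {0<..<1} \<Longrightarrow> h j s = 0" for j
    using continuous_constant_on_closure[of "{0<..<1}" "h j" 0 0] cont that by simp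
  define p q A B :: complex
    where "p = c * of_real \<alpha> ^ k" and "q = d * of_real \<beta> ^ k"
      and "A = of_real (\<alpha>\<^sup>2)" and "B = of_real (\<beta>\<^sup>2)"
  have "p + q = 0"
    using at_0[of 0, OF h0] by (simp add: h_def p_def q_def bessel_clifford_0 flip: distrib_right)
  moreover have "(p * A + q * B) * inverse (fact (Suc k)) = h 1 0"
    by (simp add: h_def p_def q_def A_def B_def bessel_clifford_0 power2_eq_square algebra_simps
        del: fact_Suc)
  then have "p * A + q * B = 0"
    using at_0[of 1, OF h1] by (simp del: fact_Suc)
  moreover have "p * (A - B) = (p * A + q * B) - B * (p + q)" "q * (B - A) = (p * A + q * B) - A * (p + q)"
    by (simp_all add: algebra_simps)
  ultimately have "p * (A - B) = 0" "q * (B - A) = 0"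
    by simp_all
  moreover have "A \<noteq> B"
    using assms by (simp add: A_def B_def power2_eq_iff flip: of_real_power)
  ultimately show False
    using assms by (simp add: p_def q_def)
qed

lemma clamped_eigenfunction_polar_mode:
  assumes "\<alpha> > 0" "\<beta> > 0" "\<alpha> \<noteq> \<beta>" "\<kappa> = \<alpha> * \<beta>"
    and "(c, d) \<noteq> (0, 0)" "bessel_system \<kappa> k \<alpha> c d"
  shows "clamped_eigenfunction \<kappa> (\<alpha>\<^sup>2 + \<beta>\<^sup>2)
    (polar_mode k (\<lambda>r. c * of_real (bessel_J k (\<alpha> * r)) + d * of_real (bessel_J k (\<beta> * r))))"
proof -
  have "\<kappa> / \<alpha> = \<beta>" using assms by simp
  with assms show ?thesis
    unfolding clamped_eigenfunction_def polar_mode_eq_cylinder_wave bessel_system_def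
    by (auto intro!: clamped_solution_cylinder_wave cylinder_wave_independent)
qed

text \<open>\<open>bessel_F \<kappa> k \<alpha>\<close> is exactly the determinant of the
  system.\<close>

lemma bessel_system_nontrivial:
  assumes "bessel_F \<kappa> k \<alpha> = 0"
  shows "\<exists>c d. (c, d) \<noteq> (0, 0) \<and> bessel_system \<kappa> k \<alpha> c d"
proof -
  let ?J = "bessel_J k" and ?D = "\<lambda>x. x * deriv (bessel_J k) x"
  let ?\<beta> = "\<kappa> / \<alpha>"
  have det: "?J \<alpha> * ?D ?\<beta> = ?J ?\<beta> * ?D \<alpha>"
    using assms by (simp add: bessel_F_def mult_ac)
  have sys: "bessel_system \<kappa> k \<alpha> (of_real c) (of_real d)"
    if "c * ?J \<alpha> + d * ?J ?\<beta> = 0" "c * ?D \<alpha> + d * ?D ?\<beta> = 0" for c d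
    using that unfolding bessel_system_def by (metis of_real_add of_real_mult of_real_0)
  have nz: "\<exists>c d. (c, d) \<noteq> (0, 0) \<and> bessel_system \<kappa> k \<alpha> c d"
    if "c * ?J \<alpha> + d * ?J ?\<beta> = 0" "c * ?D \<alpha> + d * ?D ?\<beta> = 0" "c \<noteq> 0 \<or> d \<noteq> 0" for c d
    using sys[OF that(1,2)] that(3) by (intro exI[of _ "of_real c"] exI[of _ "of_real d"]) auto
  \<comment> \<open>A vector orthogonal to a nonzero row solves both equations, since the
    determinant vanishes. If both rows are zero, \<open>(1, 0)\<close> will do.\<close>
  show ?thesis
  proof (cases "?J \<alpha> = 0 \<and> ?J ?\<beta> = 0")
    case True
    show ?thesis
    proof (cases "?D \<alpha> = 0 \<and> ?D ?\<beta> = 0")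
      case True': True
      show ?thesis by (rule nz[of 1 0]) (use True True' in auto)
    next
      case False
      show ?thesis by (rule nz[of "?D ?\<beta>" "- ?D \<alpha>"]) (use True False in auto)
    qed
  next
    case False
    show ?thesis
      by (rule nz[of "?J ?\<beta>" "- ?J \<alpha>"]) (use False det in auto)
  qed
qed

theorem theorem4p3:
  fixes k :: nat and \<kappa> :: real
  assumes "\<kappa> > 0"
  shows "\<exists>\<alpha> :: int \<Rightarrow> real.
    strict_mono \<alpha> \<and>
    range \<alpha> = {x. x > 0 \<and> bessel_F \<kappa> k x = 0} \<and>
    (\<forall>l\<ge>0. \<alpha> (- l) = \<kappa> / \<alpha> l) \<and>
    \<alpha> 0 = sqrt \<kappa> \<and>
    (\<forall>l>0. \<alpha> l > sqrt \<kappa> \<and> sqrt \<kappa> > \<alpha> (- l)) \<and>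
    filterlim \<alpha> at_top at_top \<and>
    (\<alpha> \<longlongrightarrow> 0) at_bot \<and>
    (\<forall>l. l \<noteq> 0 \<longrightarrow>
      (\<exists>\<mu>. \<mu> = (\<alpha> l)\<^sup>2 + \<kappa>\<^sup>2 / (\<alpha> l)\<^sup>2 \<and>
           \<mu> = (\<alpha> l)\<^sup>2 + (\<alpha> (- l))\<^sup>2 \<and>
           clamped_eigenvalue \<kappa> \<mu> \<and>
           (\<exists>c d. (c, d) \<noteq> (0, 0) \<and> bessel_system \<kappa> k (\<alpha> l) c d) \<and>
           (\<forall>c d. (c, d) \<noteq> (0, 0) \<and> bessel_system \<kappa> k (\<alpha> l) c d \<longrightarrow>
              clamped_eigenfunction \<kappa> \<mu>
                (polar_mode k (\<lambda>r. c * of_real (bessel_J k (\<alpha> l * r))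
                                  + d * of_real (bessel_J k (\<alpha> (- l) * r)))))))"
proof -
  obtain \<alpha> :: "int \<Rightarrow> real" where mono: "strict_mono \<alpha>"
    and range: "range \<alpha> = {x. x > 0 \<and> bessel_F \<kappa> k x = 0}"
    and refl: "\<And>l. \<alpha> (- l) = \<kappa> / \<alpha> l" and zero: "\<alpha> 0 = sqrt \<kappa>"
    and lim: "filterlim \<alpha> at_top at_top" "(\<alpha> \<longlongrightarrow> 0) at_bot"
    using bessel_F_zeros_enumeration[OF assms, of k] by blast
  have pos: "\<alpha> l > 0" and F: "bessel_F \<kappa> k (\<alpha> l) = 0" for l
    using range by auto
  have sep: "\<alpha> l > sqrt \<kappa> \<and> sqrt \<kappa> > \<alpha> (- l)" if "l > 0" for l
    using that strict_monoD[OF mono, of 0 l] strict_monoD[OF mono, of "- l" 0] zero by simp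
  have prod: "\<kappa> = \<alpha> l * \<alpha> (- l)" for l
    using refl[of l] pos[of l] by simp
  have eigen: "clamped_eigenfunction \<kappa> ((\<alpha> l)\<^sup>2 + (\<alpha> (- l))\<^sup>2)
      (polar_mode k (\<lambda>r. c * of_real (bessel_J k (\<alpha> l * r)) + d * of_real (bessel_J k (\<alpha> (- l) * r))))"
    if "l \<noteq> 0" "(c, d) \<noteq> (0, 0)" "bessel_system \<kappa> k (\<alpha> l) c d" for l c d
  proof (rule clamped_eigenfunction_polar_mode[OF pos pos _ prod that(2,3)])
    \<comment> \<open>This excludes \<open>l = 0\<close>, where the two profiles coincide and
      \<open>c = - d\<close> would give the zero function.\<close>
    show "\<alpha> l \<noteq> \<alpha> (- l)"
      using that(1) strict_mono_eq[OF mono, of l "- l"] by simp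
  qed
  have modes: "\<exists>\<mu>. \<mu> = (\<alpha> l)\<^sup>2 + \<kappa>\<^sup>2 / (\<alpha> l)\<^sup>2 \<and> \<mu> = (\<alpha> l)\<^sup>2 + (\<alpha> (- l))\<^sup>2 \<and> clamped_eigenvalue \<kappa> \<mu> \<and>
      (\<exists>c d. (c, d) \<noteq> (0, 0) \<and> bessel_system \<kappa> k (\<alpha> l) c d) \<and>
      (\<forall>c d. (c, d) \<noteq> (0, 0) \<and> bessel_system \<kappa> k (\<alpha> l) c d \<longrightarrow>
        clamped_eigenfunction \<kappa> \<mu>
          (polar_mode k (\<lambda>r. c * of_real (bessel_J k (\<alpha> l * r)) + d * of_real (bessel_J k (\<alpha> (- l) * r)))))"
    if "l \<noteq> 0" for l
  proof (intro exI[of _ "(\<alpha> l)\<^sup>2 + (\<alpha> (- l))\<^sup>2"] conjI)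
    show "(\<alpha> l)\<^sup>2 + (\<alpha> (- l))\<^sup>2 = (\<alpha> l)\<^sup>2 + \<kappa>\<^sup>2 / (\<alpha> l)\<^sup>2"
      by (simp add: refl power_divide)
    show ex: "\<exists>c d. (c, d) \<noteq> (0, 0) \<and> bessel_system \<kappa> k (\<alpha> l) c d"
      by (rule bessel_system_nontrivial[OF F])
    then show "clamped_eigenvalue \<kappa> ((\<alpha> l)\<^sup>2 + (\<alpha> (- l))\<^sup>2)"
      unfolding clamped_eigenvalue_def using eigen[OF that] by blast
  qed (use eigen[OF that] in auto)
  show ?thesis
    by (intro exI[of _ \<alpha>] conjI[OF mono] conjI[OF range] conjI[OF _ conjI[OF zero]]
        conjI[OF _ conjI[OF lim(1)]] conjI[OF lim(2)] allI impI refl sep modes)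
qed

end
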